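(* Let $K$ be a field, $\alpha$ an automorphism of $K$, and $\sum_{i\geq 0} a_i x^i \in K[\![x;\alpha]\!]$. There exist an integer $n \geq 1$ and constants $c_1,\dots,c_n \in K$ such that the coefficients satisfy the linear recurrence relation $$a_{i+n} = c_1\alpha(a_{i+(n-1)}) + c_2\alpha^2(a_{i+(n-2)}) + \dots + c_n\alpha^n(a_i) \quad\text{for all } i \geq 0$$ if and only if there exists some $m \geq 1$ such that the determinants of the $(k+1)\times(k+1)$ matrices $$\Delta_k = \begin{bmatrix} \alpha^k(a_0) & \alpha^{k-1}(a_{1}) & \dots & \alpha(a_{k-1}) & a_{k} \\ \alpha^k(a_{1}) & \alpha^{k-1}(a_{2}) & \dots &\alpha(a_{k}) & a_{k+1} \\ \vdots & & \ddots & &\vdots\\ \alpha^k(a_{k}) & \alpha^{k-1}(a_{k+1}) & \dots& \alpha(a_{2k-1}) & a_{2k} \end{bmatrix}$$ are zero for all $k \geq m$.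
   Context: $K[\![x;\alpha]\!]$ is the ring of formal power series $\sum_{i\geq 0} a_i x^i$ with $a_i \in K$ and multiplication determined by $xr=\alpha(r)x$ for $r\in K$. The matrix $\Delta_k$ has $(r,s)$ entry $\alpha^{k-s}(a_{r+s})$ for $0\leq r,s\leq k$. *)

theory Defs
  imports
    "Jordan_Normal_Form.Determinant"
    "HOL-Computational_Algebra.Formal_Power_Series"
    "HOL-Algebra.Ring"
begin

text \<open>
  The skew power series ring has the same underlying additive group as the type of ordinary
  formal power series; only the multiplication is twisted. The product is
  the one determined by additivity and \<open>(a x^i) (b x^j) = a \<alpha>^i(b) x^(i+j)\<close>.
  The ordinary product on the type \<open>fps\<close> plays no role.
\<close>

definition skew_mult :: "('a::field \<Rightarrow> 'a) \<Rightarrow> 'a fps \<Rightarrow> 'a fps \<Rightarrow> 'a fps" where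
  "skew_mult \<alpha> f g =
     Abs_fps (\<lambda>n. \<Sum>i=0..n. fps_nth f i * (\<alpha> ^^ i) (fps_nth g (n - i)))"

definition skew_fps_ring :: "('a::field \<Rightarrow> 'a) \<Rightarrow> 'a fps ring" where
  "skew_fps_ring \<alpha> =
     \<lparr>carrier = UNIV, mult = skew_mult \<alpha>, one = 1, zero = 0, add = (+)\<rparr>"

definition skew_hankel_mat :: "('a::field \<Rightarrow> 'a) \<Rightarrow> (nat \<Rightarrow> 'a) \<Rightarrow> nat \<Rightarrow> 'a mat" where
  "skew_hankel_mat \<alpha> a k = mat (k + 1) (k + 1) (\<lambda>(r, s). (\<alpha> ^^ (k - s)) (a (r + s)))"

lemma skew_mult_nth:
  "fps_nth (skew_mult \<alpha> f g) n = (\<Sum>i=0..n. fps_nth f i * (\<alpha> ^^ i) (fps_nth g (n - i)))"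
  by (simp add: skew_mult_def)

lemma field_hom_funpow:
  fixes \<alpha> :: "'a::field \<Rightarrow> 'a"
  assumes "field_hom \<alpha>"
  shows "field_hom (\<alpha> ^^ n)"
proof -
  interpret field_hom \<alpha> by fact
  have "(\<alpha> ^^ n) 0 = 0" for n
    by (induction n) simp_all
  moreover have "(\<alpha> ^^ n) 1 = 1" for n
    by (induction n) simp_all
  moreover have "(\<alpha> ^^ n) (x + y) = (\<alpha> ^^ n) x + (\<alpha> ^^ n) y" for n x y
    by (induction n) (auto simp: hom_distribs)
  moreover have "(\<alpha> ^^ n) (x * y) = (\<alpha> ^^ n) x * (\<alpha> ^^ n) y" for n x y
    by (induction n) (auto simp: hom_distribs)
  ultimately show ?thesis
    by unfold_locales auto
qed

text \<open>The defining relation \<open>x r = \<alpha>(r) x\<close>:\<close>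

lemma skew_mult_X_const:
  assumes "field_hom \<alpha>"
  shows "skew_mult \<alpha> fps_X (fps_const r) = skew_mult \<alpha> (fps_const (\<alpha> r)) fps_X"
proof (rule fps_ext)
  fix n
  interpret p: field_hom "\<alpha> ^^ k" for k using field_hom_funpow[OF assms] .
  interpret field_hom \<alpha> by fact
  have "fps_nth (skew_mult \<alpha> fps_X (fps_const r)) n = (\<Sum>i=0..n. if i = 1 then (if n = 1 then \<alpha> r else 0) else 0)"
    unfolding skew_mult_nth by (intro sum.cong) auto
  moreover have "fps_nth (skew_mult \<alpha> (fps_const (\<alpha> r)) fps_X) n = (\<Sum>i=0..n. if i = 0 then (if n = 1 then \<alpha> r else 0) else 0)"
    unfolding skew_mult_nth by (intro sum.cong) auto
  ultimately show "fps_nth (skew_mult \<alpha> fps_X (fps_const r)) n = fps_nth (skew_mult \<alpha> (fps_const (\<alpha> r)) fps_X) n"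
    by auto
qed

lemma skew_mult_assoc:
  assumes "field_hom \<alpha>"
  shows "skew_mult \<alpha> (skew_mult \<alpha> f g) h = skew_mult \<alpha> f (skew_mult \<alpha> g h)"
proof (rule fps_ext)
  fix n
  interpret p: field_hom "\<alpha> ^^ k" for k using field_hom_funpow[OF assms] .
  define F where "F i j k = fps_nth f i * ((\<alpha> ^^ i) (fps_nth g j) * (\<alpha> ^^ (i + j)) (fps_nth h k))" for i j k
  have "fps_nth (skew_mult \<alpha> (skew_mult \<alpha> f g) h) n = (\<Sum>j=0..n. \<Sum>i=0..j. F i (j - i) (n - j))"
    by (simp add: skew_mult_nth F_def sum_distrib_right mult.assoc)
  also have "\<dots> = (\<Sum>i=0..n. \<Sum>j=0..n-i. F i j (n - i - j))"
    by (rule fps_mult_assoc_lemma)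
  also have "\<dots> = fps_nth (skew_mult \<alpha> f (skew_mult \<alpha> g h)) n"
    by (simp add: skew_mult_nth F_def sum_distrib_left p.hom_sum p.hom_mult funpow_add)
  finally show "fps_nth (skew_mult \<alpha> (skew_mult \<alpha> f g) h) n = fps_nth (skew_mult \<alpha> f (skew_mult \<alpha> g h)) n" .
qed

lemma ring_skew_fps_ring:
  assumes "field_hom \<alpha>"
  shows "Ring.ring (skew_fps_ring \<alpha>)"
proof -
  interpret p: field_hom "\<alpha> ^^ k" for k using field_hom_funpow[OF assms] .
  have l: "skew_mult \<alpha> 1 g = g" for g
  proof (rule fps_ext)
    fix n
    have "fps_nth (skew_mult \<alpha> 1 g) n = (\<Sum>i=0..n. if i = 0 then fps_nth g n else 0)"
      unfolding skew_mult_nth by (intro sum.cong) auto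
    then show "fps_nth (skew_mult \<alpha> 1 g) n = fps_nth g n" by simp
  qed
  have r: "skew_mult \<alpha> g 1 = g" for g
  proof (rule fps_ext)
    fix n
    have "fps_nth (skew_mult \<alpha> g 1) n = (\<Sum>i=0..n. if i = n then fps_nth g n else 0)"
      unfolding skew_mult_nth by (intro sum.cong) auto
    then show "fps_nth (skew_mult \<alpha> g 1) n = fps_nth g n" by simp
  qed
  show ?thesis
  proof (rule ringI)
    show "abelian_group (skew_fps_ring \<alpha>)"
    proof (rule abelian_groupI)
      show "\<exists>y\<in>carrier (skew_fps_ring \<alpha>). y \<oplus>\<^bsub>skew_fps_ring \<alpha>\<^esub> x = \<zero>\<^bsub>skew_fps_ring \<alpha>\<^esub>" for x
        by (rule bexI[of _ "- x"]) (auto simp: skew_fps_ring_def)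
    qed (auto simp: skew_fps_ring_def algebra_simps)
    show "Group.monoid (skew_fps_ring \<alpha>)"
      by (rule monoidI) (auto simp: skew_fps_ring_def l r skew_mult_assoc[OF assms])
  qed (auto simp: skew_fps_ring_def fps_eq_iff skew_mult_nth p.hom_add algebra_simps sum.distrib)
qed

end

theory Submission
  imports Defs
begin

text \<open>
  This is a skew version of Kronecker's rationality criterion. Write \<open>\<beta>\<close> for the inverse of
  \<open>\<alpha>\<close> and consider the infinite matrix \<open>u r s = \<beta>\<^sup>s(a (r + s))\<close>. Its leading block of size
  \<open>k + 1\<close> becomes \<open>\<Delta>\<^sub>k\<close> when \<open>\<alpha>\<^sup>k\<close> is applied to every entry, so the two determinants vanish
  together (\<open>det_skew_hankel_mat_eq_0_iff\<close>). Moving the twist into the columns in this way turns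
  the recurrence into plain linear algebra: applying \<open>\<beta>\<^sup>n\<close> to it says precisely that column \<open>n\<close>
  of \<open>u\<close> is a linear combination of columns \<open>0, \<dots>, n - 1\<close>, with coefficients that are the same
  for all rows (\<open>skew_recurrence_iff_column_combination\<close>). One direction is then immediate, since
  every leading block that contains column \<open>n\<close> has linearly dependent columns.

  For the other direction let \<open>p\<close> be the size of the largest nonsingular leading block; it exists
  because the empty block has determinant \<open>1\<close> and all large blocks are singular. Some combination of columns \<open>0, \<dots>, p - 1\<close>
  agrees with column \<open>p\<close> in the rows \<open>0, \<dots>, p - 1\<close>; let \<open>e\<close> be the difference of the two
  columns. What carries the dependence to all rows is the skew Hankel property
  \<open>u r (s + 1) = \<beta> (u (r + 1) s)\<close>: the same relation, with twisted coefficients, can be applied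
  \<open>t\<close> columns further to the right, where its error in row \<open>r\<close> is \<open>\<beta>\<^sup>t(e (r + t))\<close>. If \<open>e k\<close>
  were the first nonzero error, these relations would reduce the leading block of size \<open>k + 1\<close> to
  a nonsingular block of size \<open>p\<close> and an anti-triangular block whose anti-diagonal entries
  \<open>\<beta>\<^sup>t(e k)\<close> are nonzero. The block of size \<open>k + 1\<close> would be nonsingular, against the
  maximality of \<open>p\<close> (\<open>skew_hankel_column_combination\<close>).
\<close>

section \<open>Singular blocks of an infinite matrix\<close>

lemma det_block_eq_0_iff_columns:
  fixes u :: "nat \<Rightarrow> nat \<Rightarrow> 'a::field"
  shows "det (mat N N (\<lambda>(r, s). u r s)) = 0 \<longleftrightarrow>
    (\<exists>v. (\<exists>s<N. v s \<noteq> 0) \<and> (\<forall>r<N. (\<Sum>s<N. u r s * v s) = 0))"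
    (is "det ?A = 0 \<longleftrightarrow> ?R")
proof -
  have prod: "?A *\<^sub>v w = 0\<^sub>v N \<longleftrightarrow> (\<forall>r<N. (\<Sum>s<N. u r s * w $ s) = 0)" if "w \<in> carrier_vec N" for w
    using that by (auto simp: vec_eq_iff scalar_prod_def lessThan_atLeast0)
  have nonzero: "w \<noteq> 0\<^sub>v N \<longleftrightarrow> (\<exists>s<N. w $ s \<noteq> 0)" if "w \<in> carrier_vec N" for w :: "'a vec"
    using that by (auto simp: vec_eq_iff)
  have "det ?A = 0 \<longleftrightarrow> (\<exists>w. w \<in> carrier_vec N \<and> w \<noteq> 0\<^sub>v N \<and> ?A *\<^sub>v w = 0\<^sub>v N)"
    by (rule det_0_iff_vec_prod_zero_field) simp
  also have "\<dots> \<longleftrightarrow> (\<exists>w. w \<in> carrier_vec N \<and> (\<exists>s<N. w $ s \<noteq> 0) \<and> (\<forall>r<N. (\<Sum>s<N. u r s * w $ s) = 0))"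
    using prod nonzero by blast
  also have "\<dots> \<longleftrightarrow> ?R"
  proof
    assume ?R
    then obtain v where "\<exists>s<N. v s \<noteq> 0" "\<forall>r<N. (\<Sum>s<N. u r s * v s) = 0"
      by blast
    then show "\<exists>w. w \<in> carrier_vec N \<and> (\<exists>s<N. w $ s \<noteq> 0) \<and> (\<forall>r<N. (\<Sum>s<N. u r s * w $ s) = 0)"
      by (intro exI[of _ "vec N v"]) auto
  qed blast
  finally show ?thesis .
qed

lemma det_block_eq_0_iff_rows:
  fixes u :: "nat \<Rightarrow> nat \<Rightarrow> 'a::field"
  shows "det (mat N N (\<lambda>(r, s). u r s)) = 0 \<longleftrightarrow>
    (\<exists>v. (\<exists>r<N. v r \<noteq> 0) \<and> (\<forall>s<N. (\<Sum>r<N. v r * u r s) = 0))"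
proof -
  have "transpose_mat (mat N N (\<lambda>(r, s). u r s)) = mat N N (\<lambda>(r, s). u s r)"
    by auto
  then have "det (mat N N (\<lambda>(r, s). u r s)) = det (mat N N (\<lambda>(r, s). u s r))"
    using det_transpose[of "mat N N (\<lambda>(r, s). u r s)" N] by simp
  then show ?thesis
    using det_block_eq_0_iff_columns[of N "\<lambda>r s. u s r"] by (simp add: mult.commute)
qed

lemma solve_nonsingular_block:
  fixes u :: "nat \<Rightarrow> nat \<Rightarrow> 'a::field"
  assumes "det (mat p p (\<lambda>(r, s). u r s)) \<noteq> 0"
  obtains d where "\<And>r. r < p \<Longrightarrow> b r = (\<Sum>l<p. d l * u r l)"
proof -
  let ?A = "mat p p (\<lambda>(r, s). u r s)"
  have "?A \<in> Units (ring_mat TYPE('a) p ())"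
    by (rule det_non_zero_imp_unit) (use assms in auto)
  then obtain B where B: "B \<in> carrier_mat p p" "?A * B = 1\<^sub>m p"
    unfolding Units_def ring_mat_def by auto
  define w where "w = B *\<^sub>v vec p b"
  have "w \<in> carrier_vec p"
    using B by (auto simp: w_def)
  have "?A *\<^sub>v w = (?A * B) *\<^sub>v vec p b"
    unfolding w_def using B by (intro assoc_mult_mat_vec[symmetric]) auto
  then have w: "?A *\<^sub>v w = vec p b"
    by (simp add: B(2))
  show thesis
  proof (rule that[of "\<lambda>l. w $ l"])
    fix r assume "r < p"
    then have "b r = (?A *\<^sub>v w) $ r"
      by (simp add: w)
    with \<open>r < p\<close> \<open>w \<in> carrier_vec p\<close> show "b r = (\<Sum>l<p. w $ l * u r l)"
      by (auto simp: scalar_prod_def lessThan_atLeast0 mult.commute)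
  qed
qed

section \<open>Column dependence in skew Hankel matrices\<close>

lemma skew_hankel_shift:
  assumes "\<And>r s. u r (Suc s) = \<beta> (u (Suc r) s)"
  shows "u r (s + t) = (\<beta> ^^ t) (u (r + t) s)"
  by (induction t arbitrary: r) (simp_all add: assms)

text \<open>
  A left kernel vector \<open>v\<close> of the block of size \<open>k + 1\<close> also annihilates the errors
  \<open>\<beta>\<^sup>t(e (r + t))\<close> of the shifted relations, because each of them is a combination of columns of
  that block as long as \<open>p + t \<le> k\<close>. If \<open>e k\<close> is the first nonzero error, the shift by \<open>t\<close> isolates
  the entry \<open>v (k - t)\<close> and forces it to vanish, so that \<open>v\<close> is supported on the first \<open>p\<close> rows
  and contradicts the nonsingularity of the block of size \<open>p\<close>.
\<close>

lemma skew_hankel_next_error_zero: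
  fixes u :: "nat \<Rightarrow> nat \<Rightarrow> 'a::field"
  assumes "field_hom \<beta>"
    and hankel: "\<And>r s. u r (Suc s) = \<beta> (u (Suc r) s)"
    and nonsingular: "det (mat p p (\<lambda>(r, s). u r s)) \<noteq> 0"
    and singular: "det (mat (Suc k) (Suc k) (\<lambda>(r, s). u r s)) = 0"
    and "p \<le> k"
    and before: "\<And>r. r < k \<Longrightarrow> u r p = (\<Sum>l<p. d l * u r l)"
  shows "u k p = (\<Sum>l<p. d l * u k l)"
proof (rule ccontr)
  interpret p: field_hom "\<beta> ^^ t" for t
    using field_hom_funpow[OF assms(1)] .
  define e where "e r = u r p - (\<Sum>l<p. d l * u r l)" for r
  assume "u k p \<noteq> (\<Sum>l<p. d l * u k l)"
  then have "e k \<noteq> 0"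
    by (simp add: e_def)
  have e_before: "e r = 0" if "r < k" for r
    using before[OF that] by (simp add: e_def)
  obtain v where v_nonzero: "\<exists>r<Suc k. v r \<noteq> 0"
    and kernel: "\<And>s. s < Suc k \<Longrightarrow> (\<Sum>r<Suc k. v r * u r s) = 0"
    using singular unfolding det_block_eq_0_iff_rows by blast
  have shifted_error:
    "(\<beta> ^^ t) (e (r + t)) = u r (p + t) - (\<Sum>l<p. (\<beta> ^^ t) (d l) * u r (l + t))" for r t
    by (simp add: e_def p.hom_minus p.hom_sum p.hom_mult skew_hankel_shift[of u \<beta>, OF hankel])
  have orthogonal: "(\<Sum>r<Suc k. v r * (\<beta> ^^ t) (e (r + t))) = 0" if "p + t \<le> k" for t
  proof -
    have "(\<Sum>r<Suc k. v r * (\<beta> ^^ t) (e (r + t))) =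
        (\<Sum>r<Suc k. v r * u r (p + t)) - (\<Sum>r<Suc k. \<Sum>l<p. (\<beta> ^^ t) (d l) * (v r * u r (l + t)))"
      unfolding shifted_error
      by (simp only: right_diff_distrib sum_subtractf sum_distrib_left mult.left_commute)
    also have "(\<Sum>r<Suc k. \<Sum>l<p. (\<beta> ^^ t) (d l) * (v r * u r (l + t))) =
        (\<Sum>l<p. (\<beta> ^^ t) (d l) * (\<Sum>r<Suc k. v r * u r (l + t)))"
      unfolding sum_distrib_left by (rule sum.swap)
    also have "\<dots> = 0"
      using that by (intro sum.neutral ballI) (simp add: kernel del: sum.lessThan_Suc)
    finally show ?thesis
      using that by (simp add: kernel del: sum.lessThan_Suc)
  qed
  have v_back: "v (k - t) = 0" if "p + t \<le> k" for t
    using that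
  proof (induction t rule: less_induct)
    case (less t)
    \<comment> \<open>Rows above \<open>k - t\<close> meet errors that are zero, rows below it entries of \<open>v\<close> that
      are already known to be zero.\<close>
    have others: "v r * (\<beta> ^^ t) (e (r + t)) = 0" if "r \<in> {..<Suc k} - {k - t}" for r
    proof (cases "r + t < k")
      case True
      then show ?thesis
        by (simp add: e_before)
    next
      case False
      then have "k - r < t" "k - (k - r) = r" "p + (k - r) \<le> k"
        using that less.prems by auto
      then show ?thesis
        using less.IH[of "k - r"] by simp
    qed
    have "(\<Sum>r<Suc k. v r * (\<beta> ^^ t) (e (r + t))) = v (k - t) * (\<beta> ^^ t) (e (k - t + t)) +
        (\<Sum>r\<in>{..<Suc k} - {k - t}. v r * (\<beta> ^^ t) (e (r + t)))"
      by (rule sum.remove) auto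
    also have "(\<Sum>r\<in>{..<Suc k} - {k - t}. v r * (\<beta> ^^ t) (e (r + t))) = 0"
      using others by (intro sum.neutral ballI)
    finally have "v (k - t) * (\<beta> ^^ t) (e (k - t + t)) = 0"
      using orthogonal[OF less.prems] by (simp only: add_0_right)
    with less.prems \<open>e k \<noteq> 0\<close> show ?case
      by simp
  qed
  have v_tail: "v r = 0" if "p \<le> r" "r \<le> k" for r
    using v_back[of "k - r"] that by simp
  have "(\<Sum>r<p. v r * u r s) = 0" if "s < p" for s
  proof -
    have "(\<Sum>r<p. v r * u r s) = (\<Sum>r<Suc k. v r * u r s)"
      using \<open>p \<le> k\<close> v_tail by (intro sum.mono_neutral_left) auto
    then show ?thesis
      using kernel[of s] that \<open>p \<le> k\<close> by simp
  qed
  then have "v r = 0" if "r < p" for r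
    using nonsingular that unfolding det_block_eq_0_iff_rows by blast
  then show False
    using v_nonzero v_tail by (metis less_Suc_eq_le not_le)
qed

lemma skew_hankel_column_combination:
  fixes u :: "nat \<Rightarrow> nat \<Rightarrow> 'a::field"
  assumes "field_hom \<beta>"
    and hankel: "\<And>r s. u r (Suc s) = \<beta> (u (Suc r) s)"
    and nonsingular: "det (mat p p (\<lambda>(r, s). u r s)) \<noteq> 0"
    and singular: "\<And>k. p \<le> k \<Longrightarrow> det (mat (Suc k) (Suc k) (\<lambda>(r, s). u r s)) = 0"
  obtains d where "\<And>r. u r p = (\<Sum>l<p. d l * u r l)"
proof -
  obtain d where d: "\<And>r. r < p \<Longrightarrow> u r p = (\<Sum>l<p. d l * u r l)"
    using solve_nonsingular_block[OF nonsingular, of "\<lambda>r. u r p"] by blast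
  have "u r p = (\<Sum>l<p. d l * u r l)" for r
  proof (induction r rule: less_induct)
    case (less r)
    show ?case
    proof (cases "r < p")
      case True
      then show ?thesis
        by (rule d)
    next
      case False
      then have "p \<le> r"
        by simp
      with singular show ?thesis
        by (intro skew_hankel_next_error_zero[of \<beta> u p r, OF assms(1) hankel nonsingular] less.IH)
    qed
  qed
  then show thesis
    by (rule that)
qed

section \<open>Untwisting the matrices and the recurrence\<close>

lemma funpow_cancel_inverse:
  assumes "\<And>x. \<alpha> (\<beta> x) = x" and "s \<le> k"
  shows "(\<alpha> ^^ k) ((\<beta> ^^ s) x) = (\<alpha> ^^ (k - s)) x"
proof -
  have "(\<alpha> ^^ s) ((\<beta> ^^ s) x) = x"
    by (induction s) (simp_all add: funpow_swap1[of \<alpha>] assms(1))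
  moreover have "\<alpha> ^^ k = \<alpha> ^^ (k - s) \<circ> \<alpha> ^^ s"
    using assms(2) by (metis funpow_add le_add_diff_inverse2)
  ultimately show ?thesis
    by simp
qed

lemma det_skew_hankel_mat_eq_0_iff:
  assumes "field_hom \<alpha>" and "\<And>x. \<alpha> (\<beta> x) = x"
  shows "det (skew_hankel_mat \<alpha> a k) = 0 \<longleftrightarrow>
    det (mat (Suc k) (Suc k) (\<lambda>(r, s). (\<beta> ^^ s) (a (r + s)))) = 0"
proof -
  interpret p: field_hom "\<alpha> ^^ t" for t
    using field_hom_funpow[OF assms(1)] .
  have "skew_hankel_mat \<alpha> a k =
      map_mat (\<alpha> ^^ k) (mat (Suc k) (Suc k) (\<lambda>(r, s). (\<beta> ^^ s) (a (r + s))))"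
    by (intro eq_matI) (auto simp: skew_hankel_mat_def funpow_cancel_inverse[of \<alpha> \<beta>, OF assms(2)])
  then show ?thesis
    by simp
qed

lemma skew_recurrence_iff_column_combination:
  assumes "field_hom \<alpha>" and "\<And>x. \<alpha> (\<beta> x) = x"
  shows "(\<exists>c. \<forall>i. a (i + n) = (\<Sum>j=1..n. c j * (\<alpha> ^^ j) (a (i + (n - j))))) \<longleftrightarrow>
    (\<exists>d. \<forall>r. (\<beta> ^^ n) (a (r + n)) = (\<Sum>l<n. d l * (\<beta> ^^ l) (a (r + l))))"
    (is "?rec \<longleftrightarrow> ?comb")
proof -
  interpret p: field_hom "\<alpha> ^^ t" for t
    using field_hom_funpow[OF assms(1)] .
  note partial = funpow_cancel_inverse[of \<alpha> \<beta>, OF assms(2)]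
  have cancel: "(\<alpha> ^^ n) ((\<beta> ^^ n) x) = x" for x
    by (simp add: partial)
  have reindex: "(\<Sum>j=1..n. g j) = (\<Sum>l<n. g (n - l))" for g :: "nat \<Rightarrow> 'a"
    by (rule sum.reindex_bij_witness[of _ "\<lambda>l. n - l" "\<lambda>j. n - j"]) auto
  have twist: "(\<beta> ^^ n) (a (r + n)) = (\<Sum>l<n. d l * (\<beta> ^^ l) (a (r + l))) \<longleftrightarrow>
      a (r + n) = (\<Sum>l<n. (\<alpha> ^^ n) (d l) * (\<alpha> ^^ (n - l)) (a (r + l)))" for d r
  proof -
    have "(\<beta> ^^ n) (a (r + n)) = (\<Sum>l<n. d l * (\<beta> ^^ l) (a (r + l))) \<longleftrightarrow>
        (\<alpha> ^^ n) ((\<beta> ^^ n) (a (r + n))) = (\<alpha> ^^ n) (\<Sum>l<n. d l * (\<beta> ^^ l) (a (r + l)))"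
      by (rule p.eq_iff[symmetric])
    then show ?thesis
      by (simp add: cancel p.hom_sum p.hom_mult partial)
  qed
  show ?thesis
  proof
    assume ?rec
    then obtain c where c: "\<And>i. a (i + n) = (\<Sum>l<n. c (n - l) * (\<alpha> ^^ (n - l)) (a (i + (n - (n - l)))))"
      unfolding reindex by blast
    have "a (r + n) = (\<Sum>l<n. (\<alpha> ^^ n) ((\<beta> ^^ n) (c (n - l))) * (\<alpha> ^^ (n - l)) (a (r + l)))" for r
      by (subst c) (simp add: cancel)
    then show ?comb
      unfolding twist by (intro exI[of _ "\<lambda>l. (\<beta> ^^ n) (c (n - l))"] allI)
  next
    assume ?comb
    then obtain d where d: "\<And>r. a (r + n) = (\<Sum>l<n. (\<alpha> ^^ n) (d l) * (\<alpha> ^^ (n - l)) (a (r + l)))"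
      unfolding twist by blast
    show ?rec
      unfolding reindex by (rule exI[of _ "\<lambda>j. (\<alpha> ^^ n) (d (n - j))"], subst d) simp
  qed
qed

section \<open>The criterion\<close>

theorem theorem1p3p6:
  fixes \<alpha> :: "'a::field \<Rightarrow> 'a" and f :: "'a fps" and a :: "nat \<Rightarrow> 'a"
  assumes "field_isom \<alpha>"
    and "f \<in> carrier (skew_fps_ring \<alpha>)"
    and "\<And>i. a i = fps_nth f i"
  shows "(\<exists>n\<ge>1. \<exists>c :: nat \<Rightarrow> 'a. \<forall>i.
            a (i + n) = (\<Sum>j=1..n. c j * (\<alpha> ^^ j) (a (i + (n - j)))))
     \<longleftrightarrow> (\<exists>m\<ge>1. \<forall>k\<ge>m. det (skew_hankel_mat \<alpha> a k) = 0)"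
proof -
  interpret \<alpha>: field_isom \<alpha> by fact
  define \<beta> where "\<beta> = inv_into UNIV \<alpha>"
  interpret \<beta>: field_hom \<beta>
    unfolding \<beta>_def by unfold_locales (simp_all add: \<alpha>.inv.hom_add \<alpha>.inv.hom_mult)
  have inverse: "\<alpha> (\<beta> x) = x" for x
    by (simp add: \<beta>_def)
  define u where "u r s = (\<beta> ^^ s) (a (r + s))" for r s
  have hankel: "u r (Suc s) = \<beta> (u (Suc r) s)" for r s
    by (simp add: u_def)
  define D where "D N = det (mat N N (\<lambda>(r, s). u r s))" for N
  have det_iff: "det (skew_hankel_mat \<alpha> a k) = 0 \<longleftrightarrow> D (Suc k) = 0" for k
    unfolding D_def u_def using \<alpha>.field_hom_axioms inverse by (rule det_skew_hankel_mat_eq_0_iff)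
  have rec_iff: "(\<exists>c. \<forall>i. a (i + n) = (\<Sum>j=1..n. c j * (\<alpha> ^^ j) (a (i + (n - j))))) \<longleftrightarrow>
      (\<exists>d. \<forall>r. u r n = (\<Sum>l<n. d l * u r l))" for n
    unfolding u_def using \<alpha>.field_hom_axioms inverse by (rule skew_recurrence_iff_column_combination)
  show ?thesis
    unfolding rec_iff det_iff
  proof
    assume "\<exists>n\<ge>1. \<exists>d. \<forall>r. u r n = (\<Sum>l<n. d l * u r l)"
    then obtain n d where "n \<ge> 1" and d: "\<And>r. u r n = (\<Sum>l<n. d l * u r l)"
      by blast
    have "D (Suc k) = 0" if "n \<le> k" for k
    proof -
      define v where "v s = (if s < n then - d s else if s = n then 1 else 0)" for s
      have "(\<Sum>s<Suc k. u r s * v s) = 0" for r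
      proof -
        have "(\<Sum>s<Suc k. u r s * v s) = (\<Sum>s<Suc n. u r s * v s)"
          using that by (intro sum.mono_neutral_right) (auto simp: v_def)
        also have "\<dots> = 0"
          by (simp add: v_def d sum_negf mult.commute)
        finally show ?thesis .
      qed
      moreover have "v n \<noteq> 0"
        by (simp add: v_def)
      ultimately show ?thesis
        unfolding D_def det_block_eq_0_iff_columns using that by (metis less_Suc_eq_le)
    qed
    then show "\<exists>m\<ge>1. \<forall>k\<ge>m. D (Suc k) = 0"
      using \<open>n \<ge> 1\<close> by blast
  next
    assume "\<exists>m\<ge>1. \<forall>k\<ge>m. D (Suc k) = 0"
    then obtain m where m: "\<And>k. m \<le> k \<Longrightarrow> D (Suc k) = 0"
      by blast
    define p where "p = (GREATEST N. D N \<noteq> 0)"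
    have bound: "N \<le> m" if "D N \<noteq> 0" for N
      using that m[of "N - 1"] by (cases N) force+
    have "D 0 \<noteq> 0"
      by (simp add: D_def)
    then have "D p \<noteq> 0"
      unfolding p_def using bound by (rule GreatestI_nat)
    moreover have "D (Suc k) = 0" if "p \<le> k" for k
      using Greatest_le_nat[of "\<lambda>N. D N \<noteq> 0" "Suc k" m] bound that unfolding p_def by fastforce
    ultimately obtain d where d: "\<And>r. u r p = (\<Sum>l<p. d l * u r l)"
      unfolding D_def using skew_hankel_column_combination[of \<beta> u p, OF \<beta>.field_hom_axioms hankel] by blast
    show "\<exists>n\<ge>1. \<exists>d. \<forall>r. u r n = (\<Sum>l<n. d l * u r l)"
    proof (cases "p = 0")
      case True
      \<comment> \<open>Here column \<open>0\<close> is the empty combination, so every \<open>a i\<close> is zero, and the order must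
        still be raised to \<open>1\<close>.\<close>
      then have "u r 0 = 0" for r
        using d[of r] by simp
      then have "u r 1 = 0" for r
        using hankel[of r 0] by simp
      then show ?thesis
        by (intro exI[of _ 1] conjI exI[of _ "\<lambda>_. 0"]) auto
    next
      case False
      then show ?thesis
        using d by (intro exI[of _ p]) auto
    qed
  qed
qed

end
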